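(* Let $n\ge 1$, let $p$ be a prime and let $r\ge 0$ be an integer. Then $$f(\underbrace{1,\dots,1}_{n-1},p^r)=\begin{cases}1, & r=0,\\ p^{(n-1)(r-1)}\,\dfrac{p^n-1}{p-1}, & r\ge 1.\end{cases}$$
   Context: An $n$-dimensional lattice is the $\mathbb{Z}$-span of $n$ linearly independent vectors in a Euclidean space; a sublattice of $\Lambda$ is a subset of $\Lambda$ which is itself an $n$-dimensional lattice. The invariant factors of a sublattice $\Lambda^*$ of $\Lambda$ are the diagonal entries $d_1\mid\cdots\mid d_n$ (positive integers) of the Smith normal form of the integer matrix expressing a basis of $\Lambda^*$ in a basis of $\Lambda$; they do not depend on the choices of bases. $f(d_1,\dots,d_n)$ is the number of sublattices of an $n$-dimensional lattice $\Lambda$ with invariant factors $d_1,\dots,d_n$ (this does not depend on $\Lambda$). In particular $f(1,\dots,1,m)$ (with $n-1$ ones) is the number of co-cyclic sublattices of index $m$, where $\Lambda^*$ is called co-cyclic if $\Lambda/\Lambda^*$ is a finite cyclic group. *)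

theory Defs
  imports "HOL-Analysis.Euclidean_Space" "Jordan_Normal_Form.Matrix"
begin

definition int_span :: "'a::euclidean_space list \<Rightarrow> 'a set" where
  "int_span B = {\<Sum>i<length B. real_of_int (c i) *\<^sub>R B ! i | c :: nat \<Rightarrow> int. True}"

definition lattice_basis :: "'a::euclidean_space list \<Rightarrow> 'a set \<Rightarrow> bool" where
  "lattice_basis B L \<longleftrightarrow> distinct B \<and> independent (set B) \<and> L = int_span B"

text \<open>The ambient space may have dimension larger than \<open>n\<close>.\<close>

definition is_lattice :: "nat \<Rightarrow> 'a::euclidean_space set \<Rightarrow> bool" where
  "is_lattice n L \<longleftrightarrow> (\<exists>B. length B = n \<and> lattice_basis B L)"

definition is_sublattice :: "nat \<Rightarrow> 'a::euclidean_space set \<Rightarrow> 'a set \<Rightarrow> bool" where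
  "is_sublattice n L' L \<longleftrightarrow> is_lattice n L' \<and> L' \<subseteq> L"

text \<open>Row \<open>i\<close> of \<open>A\<close> holds the coordinates of the \<open>i\<close>-th vector of \<open>C\<close> with respect to \<open>B\<close>.\<close>

definition expresses :: "int mat \<Rightarrow> 'a::euclidean_space list \<Rightarrow> 'a list \<Rightarrow> bool" where
  "expresses A C B \<longleftrightarrow> A \<in> carrier_mat (length C) (length B) \<and>
     (\<forall>i<length C. C ! i = (\<Sum>j<length B. real_of_int (A $$ (i, j)) *\<^sub>R B ! j))"

text \<open>\<open>ds\<close> is the diagonal of the Smith normal form of the nonsingular square matrix \<open>A\<close>;
  nonsingularity is what makes all diagonal entries positive. \<open>invertible_mat\<close> at type
  \<open>int mat\<close> means invertible over the integers.\<close>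

definition smith_diagonal :: "int mat \<Rightarrow> nat list \<Rightarrow> bool" where
  "smith_diagonal A ds \<longleftrightarrow>
     (\<forall>d\<in>set ds. 0 < d) \<and>
     (\<forall>i. Suc i < length ds \<longrightarrow> ds ! i dvd ds ! Suc i) \<and>
     (\<exists>P Q. P \<in> carrier_mat (length ds) (length ds) \<and> invertible_mat P \<and>
            Q \<in> carrier_mat (length ds) (length ds) \<and> invertible_mat Q \<and>
            A \<in> carrier_mat (length ds) (length ds) \<and>
            P * A * Q = mat_diag (length ds) (\<lambda>i. int (ds ! i)))"

text \<open>Changing the basis of \<open>L\<close> or of \<open>L'\<close> multiplies \<open>A\<close> by a unimodular matrix, so it makes no
  difference whether bases are quantified existentially or universally.\<close>

definition has_invariant_factors :: "'a::euclidean_space set \<Rightarrow> 'a set \<Rightarrow> nat list \<Rightarrow> bool" where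
  "has_invariant_factors L' L ds \<longleftrightarrow>
     (\<exists>C B A. lattice_basis C L' \<and> lattice_basis B L \<and> expresses A C B \<and> smith_diagonal A ds)"

text \<open>The function \<open>f\<close>, with the lattice in which sublattices are counted as an explicit
  argument; the dimension is the number of invariant factors.\<close>

definition num_sublattices :: "'a::euclidean_space set \<Rightarrow> nat list \<Rightarrow> nat" where
  "num_sublattices L ds =
     card {L'. is_sublattice (length ds) L' L \<and> has_invariant_factors L' L ds}"

end

theory Submission
  imports Defs "HOL-Number_Theory.Cong"
begin

text \<open>
  Write \<open>m = p ^ r\<close>. A sublattice \<open>L'\<close> has invariant factors \<open>1, \<dots>, 1, m\<close> exactly when \<open>L\<close> has a
  basis \<open>b\<close> such that \<open>L'\<close> is spanned by \<open>b\<close> with its last vector multiplied by \<open>m\<close>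
  (\<open>has_invariant_factors_iff_adapted_basis\<close>). Reading off the last coordinate with respect to \<open>b\<close>
  shows that \<open>L'\<close> is then the solution set of one congruence \<open>f x \<equiv> 0 (mod m)\<close>, where the linear
  form \<open>f\<close> is integral on \<open>L\<close> and takes the value \<open>1\<close>.

  Fix one basis \<open>B\<close> of \<open>L\<close> and record \<open>f\<close> by the integer vector of its values on \<open>B\<close>. Only the
  residues mod \<open>m\<close> matter, and multiplying the vector by a unit mod \<open>m\<close> does not change the
  sublattice. As \<open>f\<close> takes the value \<open>1\<close>, some entry is prime to \<open>p\<close>. Let \<open>j\<close> be the position of
  the last such entry and scale it to \<open>1\<close>: the entries before \<open>j\<close> are arbitrary residues, the
  entries after \<open>j\<close> are multiples of \<open>p\<close>. Counting these normal forms avoids counting orbits of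
  the unit group. Conversely every normal form \<open>w\<close> defines a sublattice of the required kind,
  because the entry \<open>1\<close> gives the adapted basis made of the vectors \<open>B ! i - w i *\<^sub>R B ! j\<close>
  for \<open>i \<noteq> j\<close>, followed by \<open>B ! j\<close> (\<open>normalized_congruence_sublattice_cocyclic\<close>), and the
  sublattice determines its normal form (\<open>normalized_vector_determined\<close>).

  With \<open>r \<ge> 1\<close> there are \<open>p ^ (r * j) * p ^ ((r - 1) * (n - 1 - j))\<close> normal forms with last
  unit entry at \<open>j\<close>, which is \<open>p ^ ((n - 1) * (r - 1)) * p ^ j\<close>; the sum over \<open>j\<close> is geometric.
  For \<open>r = 0\<close> the congruence is empty, and \<open>L\<close> itself is the only sublattice of this kind.
\<close>

section \<open>Integer spans and lattice bases\<close>

text \<open>An integer span is a span over the ring \<open>int\<close>, so the closure and minimality rules of the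
  general theory of modules apply to it.\<close>

interpretation zmod: Modules.module "\<lambda>(k::int) (x::'a::real_vector). real_of_int k *\<^sub>R x"
  by unfold_locales (auto simp: scaleR_add_right scaleR_add_left)

lemma int_span_eq_zmod_span: "int_span B = zmod.span (set B)"
proof (rule antisym)
  show "int_span B \<subseteq> zmod.span (set B)"
    unfolding int_span_def by (auto intro!: zmod.span_sum zmod.span_scale intro: zmod.span_base nth_mem)
  have "zmod.subspace (int_span B)"
    unfolding zmod.subspace_def
  proof (intro conjI ballI allI)
    show "0 \<in> int_span B" unfolding int_span_def by (rule CollectI, rule exI[of _ "\<lambda>_. 0"]) simp
  next
    fix x y assume "x \<in> int_span B" "y \<in> int_span B"
    then obtain c d where "x = (\<Sum>i<length B. real_of_int (c i) *\<^sub>R B ! i)"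
      "y = (\<Sum>i<length B. real_of_int (d i) *\<^sub>R B ! i)" unfolding int_span_def by auto
    then have "x + y = (\<Sum>i<length B. real_of_int (c i + d i) *\<^sub>R B ! i)"
      by (simp add: scaleR_add_left sum.distrib)
    then show "x + y \<in> int_span B"
      unfolding int_span_def by (intro CollectI exI[of _ "\<lambda>i. c i + d i"]) simp
  next
    fix k :: int and x assume "x \<in> int_span B"
    then obtain c where "x = (\<Sum>i<length B. real_of_int (c i) *\<^sub>R B ! i)"
      unfolding int_span_def by auto
    then have "real_of_int k *\<^sub>R x = (\<Sum>i<length B. real_of_int (k * c i) *\<^sub>R B ! i)"
      by (simp add: scaleR_sum_right)
    then show "real_of_int k *\<^sub>R x \<in> int_span B"
      unfolding int_span_def by (intro CollectI exI[of _ "\<lambda>i. k * c i"]) simp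
  qed
  moreover have "B ! i \<in> int_span B" if "i < length B" for i
  proof -
    have "(\<Sum>l<length B. real_of_int (if l = i then 1 else 0) *\<^sub>R B ! l) =
      (\<Sum>l<length B. if l = i then B ! l else 0)"
      by (intro sum.cong) auto
    also have "\<dots> = B ! i" using that by simp
    finally show ?thesis
      unfolding int_span_def by (intro CollectI exI[of _ "\<lambda>l. if l = i then 1 else 0"]) simp
  qed
  then have "set B \<subseteq> int_span B" by (auto simp: in_set_conv_nth)
  ultimately show "zmod.span (set B) \<subseteq> int_span B" by (intro zmod.span_minimal)
qed

lemma int_span_subset_span: "int_span B \<subseteq> span (set B)"
  unfolding int_span_def by (auto intro!: span_sum span_scale intro: span_base nth_mem)

lemma int_span_subsetI:
  assumes "\<And>i. i < length C \<Longrightarrow> C ! i \<in> int_span B"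
  shows "int_span C \<subseteq> int_span B"
  using assms unfolding int_span_eq_zmod_span
  by (intro zmod.span_minimal) (auto simp: in_set_conv_nth zmod.subspace_span)

text \<open>A spanning list as long as a basis is itself independent and without repetitions, by
  comparison of dimensions. This spares any direct argument for independence later on.\<close>

lemma lattice_basis_of_span:
  assumes "lattice_basis B L" "length C = length B" "set B \<subseteq> span (set C)"
  shows "lattice_basis C (int_span C)"
proof -
  from assms(1) have B: "distinct B" "independent (set B)" by (auto simp: lattice_basis_def)
  have "card (set B) \<le> card (set C)"
    using independent_span_bound[OF _ B(2) assms(3)] by simp
  then have card: "card (set C) = length C"
    using distinct_card[OF B(1)] assms(2) card_length[of C] by simp
  have "card (set B) \<le> dim (span (set C))"
    using B(2) assms(3) by (intro independent_card_le_dim) auto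
  then have "independent (set C)"
    using card distinct_card[OF B(1)] assms(2)
    by (intro card_le_dim_spanning[of _ "span (set C)"]) (auto intro: span_base)
  with card show ?thesis by (simp add: lattice_basis_def card_distinct)
qed

lemma exists_functional:
  fixes v :: "nat \<Rightarrow> real" and B :: "'a::euclidean_space list"
  assumes "lattice_basis B L"
  shows "\<exists>f::'a \<Rightarrow> real. linear f \<and> (\<forall>i<length B. f (B ! i) = v i)"
proof -
  have B: "distinct B" "independent (set B)" using assms by (auto simp: lattice_basis_def)
  have inj: "inj_on ((!) B) {..<length B}" using B(1) by (simp add: inj_on_nth)
  obtain f where f: "linear f" "\<forall>x\<in>set B. f x = v (the_inv_into {..<length B} ((!) B) x)"
    using linear_independent_extend[OF B(2), of "\<lambda>x. v (the_inv_into {..<length B} ((!) B) x)"]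
    by blast
  have "f (B ! i) = v i" if "i < length B" for i
    using f(2) the_inv_into_f_f[OF inj, of i] that by simp
  with f(1) show ?thesis by blast
qed

section \<open>Integer matrices acting on lists of vectors\<close>

definition mat_act :: "int mat \<Rightarrow> 'a::real_vector list \<Rightarrow> 'a list" where
  "mat_act M X = map (\<lambda>i. \<Sum>j<length X. real_of_int (M $$ (i, j)) *\<^sub>R X ! j) [0..<dim_row M]"

lemma length_mat_act [simp]: "length (mat_act M X) = dim_row M"
  by (simp add: mat_act_def)

lemma mat_act_mult:
  assumes "M \<in> carrier_mat a b" "N \<in> carrier_mat b (length X)"
  shows "mat_act (M * N) X = mat_act M (mat_act N X)"
proof (rule nth_equalityI)
  fix i assume "i < length (mat_act (M * N) X)"
  then have i: "i < a" using assms by simp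
  have "mat_act (M * N) X ! i
      = (\<Sum>j<length X. real_of_int (\<Sum>k<b. M $$ (i, k) * N $$ (k, j)) *\<^sub>R X ! j)"
    using i assms by (simp add: mat_act_def scalar_prod_def atLeast0LessThan)
  also have "\<dots> = (\<Sum>j<length X. \<Sum>k<b. real_of_int (M $$ (i, k) * N $$ (k, j)) *\<^sub>R X ! j)"
    by (simp add: scaleR_sum_left)
  also have "\<dots> = (\<Sum>k<b. \<Sum>j<length X. real_of_int (M $$ (i, k) * N $$ (k, j)) *\<^sub>R X ! j)"
    by (rule sum.swap)
  also have "\<dots> = mat_act M (mat_act N X) ! i"
    using i assms by (simp add: mat_act_def scaleR_sum_right)
  finally show "mat_act (M * N) X ! i = mat_act M (mat_act N X) ! i" .
qed (use assms in auto)

lemma int_span_mat_act_subset: "int_span (mat_act M X) \<subseteq> int_span X"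
proof (rule int_span_subsetI)
  fix i assume "i < length (mat_act M X)"
  then show "mat_act M X ! i \<in> int_span X"
    unfolding int_span_def by (intro CollectI exI[of _ "\<lambda>j. M $$ (i, j)"]) (simp add: mat_act_def)
qed

lemma mat_act_diag:
  assumes "length X = n"
  shows "mat_act (mat_diag n d) X = map (\<lambda>i. real_of_int (d i) *\<^sub>R X ! i) [0..<n]"
proof (rule nth_equalityI)
  fix i assume "i < length (mat_act (mat_diag n d) X)"
  then have i: "i < n" by (simp add: mat_diag_def)
  have "mat_act (mat_diag n d) X ! i = (\<Sum>j<n. real_of_int (if i = j then d j else 0) *\<^sub>R X ! j)"
    using i assms by (simp add: mat_act_def mat_diag_def)
  also have "\<dots> = (\<Sum>j<n. if j = i then real_of_int (d i) *\<^sub>R X ! i else 0)"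
    by (intro sum.cong) auto
  finally show "mat_act (mat_diag n d) X ! i = map (\<lambda>i. real_of_int (d i) *\<^sub>R X ! i) [0..<n] ! i"
    using i by simp
qed (simp add: mat_diag_def)

lemma mat_act_one: "mat_act (1\<^sub>m (length X)) X = X"
  using mat_act_diag[of X "length X" "\<lambda>_. 1"] by (simp add: map_nth)

lemma expresses_iff_mat_act:
  "expresses A C B \<longleftrightarrow> A \<in> carrier_mat (length C) (length B) \<and> C = mat_act A B"
proof (cases "A \<in> carrier_mat (length C) (length B)")
  case True
  then have "dim_row A = length C" by simp
  then have "C = mat_act A B \<longleftrightarrow>
      (\<forall>i<length C. C ! i = (\<Sum>j<length B. real_of_int (A $$ (i, j)) *\<^sub>R B ! j))"
    unfolding list_eq_iff_nth_eq length_mat_act by (simp add: mat_act_def)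
  with True show ?thesis by (simp only: expresses_def)
qed (simp add: expresses_def)

lemma invertible_mat_inverse:
  fixes P :: "'a::comm_ring_1 mat"
  assumes "invertible_mat P" "P \<in> carrier_mat n n"
  obtains P' where "P' \<in> carrier_mat n n" "P' * P = 1\<^sub>m n" "P * P' = 1\<^sub>m n"
proof -
  obtain P' where P': "P * P' = 1\<^sub>m (dim_row P)" "P' * P = 1\<^sub>m (dim_row P')"
    using assms(1) unfolding invertible_mat_def inverts_mat_def by auto
  have "dim_col P' = n" using arg_cong[OF P'(1), of dim_col] assms(2) by simp
  moreover have "dim_row P' = n" using arg_cong[OF P'(2), of dim_col] assms(2) by simp
  ultimately show thesis using P' assms(2) by (intro that[of P']) auto
qed

lemma int_span_mat_act_unimodular:
  assumes "invertible_mat M" "M \<in> carrier_mat (length X) (length X)"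
  shows "int_span (mat_act M X) = int_span X"
proof -
  obtain M' where M': "M' \<in> carrier_mat (length X) (length X)" "M' * M = 1\<^sub>m (length X)"
    using invertible_mat_inverse[OF assms] by metis
  have inverse: "mat_act M' (mat_act M X) = X"
    using mat_act_mult[OF M'(1) assms(2)] M'(2) by (simp add: mat_act_one)
  show ?thesis
    using int_span_mat_act_subset[of M X] int_span_mat_act_subset[of M' "mat_act M X"]
    unfolding inverse by (rule antisym)
qed

section \<open>Bases adapted to a sublattice\<close>

text \<open>If \<open>P * A * Q = D\<close> is the Smith normal form, then \<open>P * A = D * Q\<inverse>\<close>. Hence the basis \<open>P C\<close> of
  \<open>L'\<close> consists of the multiples by \<open>ds\<close> of the vectors of the basis \<open>Q\<inverse> B\<close> of \<open>L\<close>. In the other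
  direction an adapted basis makes the transition matrix diagonal from the start.\<close>

lemma has_invariant_factors_iff_adapted_basis:
  "has_invariant_factors L' L ds \<longleftrightarrow>
     (\<forall>d\<in>set ds. 0 < d) \<and> (\<forall>i. Suc i < length ds \<longrightarrow> ds ! i dvd ds ! Suc i) \<and>
     (\<exists>b. length b = length ds \<and> lattice_basis b L \<and>
       L' = int_span (map (\<lambda>i. real (ds ! i) *\<^sub>R b ! i) [0..<length ds]))"
  (is "?l \<longleftrightarrow> ?pos \<and> ?dvd \<and> ?r")
proof (intro iffI)
  let ?n = "length ds"
  let ?D = "mat_diag ?n (\<lambda>i. int (ds ! i))"
  assume ?l
  then obtain C B A where C: "lattice_basis C L'" and B: "lattice_basis B L"
    and ex: "expresses A C B" and sd: "smith_diagonal A ds"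
    by (auto simp: has_invariant_factors_def)
  from sd obtain P Q where PQ: "P \<in> carrier_mat ?n ?n" "invertible_mat P"
    "Q \<in> carrier_mat ?n ?n" "invertible_mat Q" and A: "A \<in> carrier_mat ?n ?n"
    and eq: "P * A * Q = ?D"
    unfolding smith_diagonal_def by blast
  have CA: "C = mat_act A B" using ex expresses_iff_mat_act by blast
  have len: "length C = ?n" "length B = ?n"
    using ex A unfolding expresses_def carrier_mat_def by simp_all
  obtain Q' where Q': "Q' \<in> carrier_mat ?n ?n" "Q' * Q = 1\<^sub>m ?n" "Q * Q' = 1\<^sub>m ?n"
    using invertible_mat_inverse[OF PQ(4,3)] .
  have "invertible_mat Q'"
    unfolding invertible_mat_def inverts_mat_def using Q' PQ(3) by (auto intro!: exI[of _ Q])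
  define b where "b = mat_act Q' B"
  have lenb: "length b = ?n" using Q'(1) by (simp add: b_def)
  have spanb: "int_span b = int_span B"
    unfolding b_def using \<open>invertible_mat Q'\<close> Q'(1) len by (intro int_span_mat_act_unimodular) auto
  have L: "L = int_span B" using B by (simp add: lattice_basis_def)
  have "set B \<subseteq> int_span B" by (simp add: int_span_eq_zmod_span zmod.span_superset)
  then have basis_b: "lattice_basis b L"
    using lattice_basis_of_span[OF B, of b] int_span_subset_span[of b] lenb len spanb L by auto
  have "P * A = P * A * (Q * Q')"
    using PQ A Q' by simp
  also have "\<dots> = ?D * Q'"
    unfolding eq[symmetric] using PQ(1,3) A Q'(1) by (subst assoc_mult_mat[of _ ?n ?n _ ?n _ ?n]) auto
  finally have PA: "P * A = ?D * Q'" .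
  have "mat_act P C = mat_act (P * A) B"
    unfolding CA using PQ(1) A len by (subst mat_act_mult) auto
  also have "\<dots> = mat_act ?D b"
    unfolding PA b_def using Q'(1) len by (subst mat_act_mult[of _ ?n ?n]) auto
  also have "\<dots> = map (\<lambda>i. real (ds ! i) *\<^sub>R b ! i) [0..<?n]"
    using lenb by (simp add: mat_act_diag)
  finally have "L' = int_span (map (\<lambda>i. real (ds ! i) *\<^sub>R b ! i) [0..<?n])"
    using int_span_mat_act_unimodular[OF PQ(2), of C] PQ(1) len C by (simp add: lattice_basis_def)
  with sd lenb basis_b show "?pos \<and> ?dvd \<and> ?r" unfolding smith_diagonal_def by blast
next
  let ?n = "length ds"
  let ?D = "mat_diag ?n (\<lambda>i. int (ds ! i))"
  assume asm: "?pos \<and> ?dvd \<and> ?r"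
  then obtain b where b: "length b = ?n" "lattice_basis b L"
    and L': "L' = int_span (map (\<lambda>i. real (ds ! i) *\<^sub>R b ! i) [0..<?n])" by blast
  define C where "C = map (\<lambda>i. real (ds ! i) *\<^sub>R b ! i) [0..<?n]"
  have C: "C = mat_act ?D b" using b(1) by (simp add: C_def mat_act_diag)
  have "set b \<subseteq> span (set C)"
  proof
    fix x assume "x \<in> set b"
    then obtain i where i: "i < ?n" "x = b ! i" using b(1) by (auto simp: in_set_conv_nth)
    moreover have "ds ! i \<in> set ds" using i(1) by simp
    then have "real (ds ! i) \<noteq> 0" using asm by (metis less_numeral_extra(3) of_nat_eq_0_iff)
    ultimately have "x = (1 / real (ds ! i)) *\<^sub>R (C ! i)" by (simp add: C_def)
    moreover have "C ! i \<in> set C" using i by (simp add: C_def)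
    ultimately show "x \<in> span (set C)" by (metis span_base span_scale)
  qed
  then have "lattice_basis C L'"
    using lattice_basis_of_span[OF b(2), of C] b(1) L' by (simp add: C_def)
  moreover have "?D \<in> carrier_mat (length C) (length b)"
    by (simp add: C_def b(1) mat_diag_def)
  with C have "expresses ?D C b" unfolding expresses_iff_mat_act by blast
  moreover have "1\<^sub>m ?n * ?D * 1\<^sub>m ?n = ?D"
    by (simp add: left_mult_one_mat[OF mat_diag_dim] right_mult_one_mat[OF mat_diag_dim])
  then have "smith_diagonal ?D ds"
    unfolding smith_diagonal_def using asm
    by (intro conjI exI[of _ "1\<^sub>m ?n"])
      (auto simp: invertible_mat_def inverts_mat_def intro!: exI[of _ "1\<^sub>m ?n"])
  ultimately show ?l using b(2) unfolding has_invariant_factors_def by blast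
qed

section \<open>Co-cyclic sublattices as solutions of one congruence\<close>

definition congruence_sublattice :: "'a::euclidean_space set \<Rightarrow> ('a \<Rightarrow> real) \<Rightarrow> nat \<Rightarrow> 'a set" where
  "congruence_sublattice L f m = {x \<in> L. \<exists>k::int. f x = real m * of_int k}"

text \<open>The form \<open>f\<close> is the last coordinate with respect to an adapted basis: it is the only
  coordinate on which membership in \<open>L'\<close> imposes a condition.\<close>

lemma cocyclic_imp_congruence_sublattice:
  fixes L :: "'a::euclidean_space set"
  assumes "has_invariant_factors L' L (replicate (n - 1) 1 @ [m])" and "n \<ge> 1"
  obtains f :: "'a \<Rightarrow> real" where "linear f" "\<And>x. x \<in> L \<Longrightarrow> f x \<in> \<int>" "\<exists>x\<in>L. f x = 1"
    "L' = congruence_sublattice L f m"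
proof -
  define ds where "ds = replicate (n - 1) 1 @ [m]"
  have lends: "length ds = n" using assms(2) by (simp add: ds_def)
  obtain b where b: "length b = n" "lattice_basis b L"
    and L': "L' = int_span (map (\<lambda>i. real (ds ! i) *\<^sub>R b ! i) [0..<n])"
    using assms(1) unfolding has_invariant_factors_iff_adapted_basis ds_def[symmetric] lends by blast
  obtain f :: "'a \<Rightarrow> real"
    where f: "linear f" and f_b: "\<forall>i<n. f (b ! i) = (if i = n - 1 then 1 else 0)"
    using exists_functional[OF b(2), of "\<lambda>i. if i = n - 1 then 1 else 0"] unfolding b(1) by blast
  have L: "L = int_span b" using b(2) by (simp add: lattice_basis_def)
  have coord: "f (\<Sum>i<n. c i *\<^sub>R b ! i) = c (n - 1)" for c
  proof -
    have "f (\<Sum>i<n. c i *\<^sub>R b ! i) = (\<Sum>i<n. c i * f (b ! i))"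
      using f by (simp add: linear_sum linear_scale)
    also have "\<dots> = (\<Sum>i<n. if i = n - 1 then c i else 0)"
      by (rule sum.cong) (use f_b in auto)
    also have "\<dots> = c (n - 1)" using assms(2) by simp
    finally show ?thesis .
  qed
  have bL: "b ! i \<in> L" if "i < n" for i
    using that b(1) unfolding L int_span_eq_zmod_span by (auto intro: zmod.span_base)
  show thesis
  proof (rule that)
    show "linear f" by (fact f)
    show "f x \<in> \<int>" if x: "x \<in> L" for x
    proof -
      obtain c :: "nat \<Rightarrow> int" where "x = (\<Sum>i<n. real_of_int (c i) *\<^sub>R b ! i)"
        using x b(1) unfolding L int_span_def by auto
      then show ?thesis using coord[of "\<lambda>i. real_of_int (c i)"] by simp
    qed
    show "\<exists>x\<in>L. f x = 1"
    proof
      show "f (b ! (n - 1)) = 1" using f_b assms(2) by simp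
      show "b ! (n - 1) \<in> L" using bL assms(2) by simp
    qed
    show "L' = congruence_sublattice L f m"
    proof (intro equalityI subsetI)
      fix x assume "x \<in> L'"
      then obtain c :: "nat \<Rightarrow> int" where
        "x = (\<Sum>i<n. real_of_int (c i) *\<^sub>R (real (ds ! i) *\<^sub>R b ! i))"
        unfolding L' int_span_def by auto
      then have x: "x = (\<Sum>i<n. real_of_int (c i * int (ds ! i)) *\<^sub>R b ! i)" by simp
      have "f x = real m * real_of_int (c (n - 1))"
        unfolding x coord by (simp add: ds_def nth_append)
      moreover have "x \<in> L" unfolding L int_span_def x b(1)
        by (intro CollectI exI[of _ "\<lambda>i. c i * int (ds ! i)"]) simp
      ultimately show "x \<in> congruence_sublattice L f m"
        by (auto simp: congruence_sublattice_def)
    next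
      fix x assume "x \<in> congruence_sublattice L f m"
      then obtain k where x: "x \<in> L" "f x = real m * real_of_int k"
        by (auto simp: congruence_sublattice_def)
      then obtain c :: "nat \<Rightarrow> int" where c: "x = (\<Sum>i<n. real_of_int (c i) *\<^sub>R b ! i)"
        using b(1) unfolding L int_span_def by auto
      with x(2) coord[of "\<lambda>i. real_of_int (c i)"]
      have k: "real_of_int (c (n - 1)) = real m * real_of_int k" by simp
      have "real_of_int (c i) *\<^sub>R b ! i
          = real_of_int ((c(n - 1 := k)) i) *\<^sub>R (real (ds ! i) *\<^sub>R b ! i)" if "i < n" for i
        using that k by (cases "i = n - 1") (auto simp: ds_def nth_append mult.commute)
      then have "x = (\<Sum>i<n. real_of_int ((c(n - 1 := k)) i) *\<^sub>R (real (ds ! i) *\<^sub>R b ! i))"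
        unfolding c by (intro sum.cong) auto
      then show "x \<in> L'" unfolding L' int_span_def
        by (intro CollectI exI[of _ "c(n - 1 := k)"]) simp
    qed
  qed
qed

text \<open>When \<open>f\<close> takes the value \<open>1\<close> on the basis vector \<open>B ! j\<close>, subtracting multiples of \<open>B ! j\<close>
  moves the other basis vectors into the kernel of \<open>f\<close>. The new basis is adapted, since the
  congruence then only concerns the coefficient of \<open>B ! j\<close>, which equals \<open>f x\<close>.\<close>

lemma normalized_congruence_sublattice_cocyclic:
  fixes w :: "nat \<Rightarrow> int" and f :: "'a::euclidean_space \<Rightarrow> real"
  assumes B: "lattice_basis B L" "length B = n" and j: "j < n" "w j = 1"
    and f: "linear f" "\<And>i. i < n \<Longrightarrow> f (B ! i) = w i" and m: "m > 0"
  shows "is_sublattice n (congruence_sublattice L f m) L"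
    and "has_invariant_factors (congruence_sublattice L f m) L (replicate (n - 1) 1 @ [m])"
proof -
  let ?K = "congruence_sublattice L f m"
  define ds where "ds = replicate (n - 1) 1 @ [m]"
  have lends: "length ds = n" using j by (simp add: ds_def)
  define e where "e i = B ! i - real_of_int (w i) *\<^sub>R B ! j" for i
  define xs where "xs = filter (\<lambda>i. i \<noteq> j) [0..<n]"
  have set_xs: "set xs = {..<n} - {j}" by (auto simp: xs_def)
  have "length xs = card (set xs)" by (rule distinct_card[symmetric]) (simp add: xs_def)
  then have len_xs: "length xs = n - 1" using j by (simp add: set_xs)
  define b where "b = map e xs @ [B ! j]"
  define C where "C = map e xs @ [real m *\<^sub>R B ! j]"
  have C_eq: "C = map (\<lambda>i. real (ds ! i) *\<^sub>R b ! i) [0..<n]"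
    using j len_xs by (auto simp: C_def b_def ds_def list_eq_iff_nth_eq nth_append)
  have lenb: "length b = n" "length C = n" using j len_xs by (auto simp: b_def C_def)
  have L: "L = zmod.span (set B)" using B(1) by (simp add: lattice_basis_def int_span_eq_zmod_span)
  have BL: "B ! i \<in> L" if "i < n" for i
    using that B(2) unfolding L by (auto intro: zmod.span_base)
  have eL: "e i \<in> L" if "i < n" for i
    unfolding e_def using that j BL unfolding L
    by (intro zmod.span_diff zmod.span_scale) auto
  \<comment> \<open>In the new basis the coefficient of \<open>B ! j\<close> is \<open>f x\<close>; the others are unchanged.\<close>
  have decompose:
    "\<exists>c::nat \<Rightarrow> int. x = (\<Sum>i\<in>set xs. real_of_int (c i) *\<^sub>R e i) + f x *\<^sub>R B ! j \<and> f x \<in> \<int>"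
    if "x \<in> L" for x
  proof -
    from that obtain c :: "nat \<Rightarrow> int" where c: "x = (\<Sum>i<n. real_of_int (c i) *\<^sub>R B ! i)"
      using B unfolding lattice_basis_def int_span_def by auto
    have fx: "f x = (\<Sum>i<n. real_of_int (c i) * w i)"
      unfolding c using f by (auto simp: linear_sum linear_scale intro!: sum.cong)
    have "x - f x *\<^sub>R B ! j = (\<Sum>i<n. real_of_int (c i) *\<^sub>R e i)"
      unfolding c[symmetric] fx e_def
      by (subst c) (simp add: scaleR_diff_right sum_subtractf scaleR_sum_left)
    also have "\<dots> = (\<Sum>i\<in>set xs. real_of_int (c i) *\<^sub>R e i)"
      unfolding set_xs using j by (subst sum.remove[of _ j]) (auto simp: e_def)
    finally have "x = (\<Sum>i\<in>set xs. real_of_int (c i) *\<^sub>R e i) + f x *\<^sub>R B ! j"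
      by (simp add: algebra_simps)
    moreover have "f x \<in> \<int>" unfolding fx by (intro Ints_sum) auto
    ultimately show ?thesis by blast
  qed
  have b: "int_span b = L"
  proof
    show "int_span b \<subseteq> L"
      unfolding int_span_eq_zmod_span
      using eL BL j by (intro zmod.span_minimal) (auto simp: b_def set_xs L zmod.subspace_span)
    show "L \<subseteq> int_span b"
    proof
      fix x assume "x \<in> L"
      with decompose obtain c :: "nat \<Rightarrow> int" and k :: int where
        "x = (\<Sum>i\<in>set xs. real_of_int (c i) *\<^sub>R e i) + real_of_int k *\<^sub>R B ! j"
        by (metis Ints_cases)
      then show "x \<in> int_span b"
        unfolding int_span_eq_zmod_span
        by (elim ssubst, intro zmod.span_add zmod.span_sum zmod.span_scale zmod.span_base)
          (simp_all add: b_def)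
    qed
  qed
  have C: "int_span C = ?K"
  proof
    have "zmod.subspace ?K"
      unfolding zmod.subspace_def congruence_sublattice_def
    proof (intro conjI ballI allI CollectI; (elim CollectE conjE exE)?)
      show "0 \<in> L" by (simp add: L zmod.span_zero)
      show "\<exists>k::int. f 0 = real m * real_of_int k"
        using f(1) by (intro exI[of _ 0]) (simp add: linear_0)
    next
      fix x y and k l :: int
      assume "x \<in> L" "y \<in> L" "f x = real m * real_of_int k" "f y = real m * real_of_int l"
      then show "x + y \<in> L" "\<exists>k::int. f (x + y) = real m * real_of_int k"
        using f(1) by (auto simp: L zmod.span_add linear_add distrib_left intro!: exI[of _ "k + l"])
    next
      fix a x and k :: int
      assume "x \<in> L" "f x = real m * real_of_int k"
      then show "real_of_int a *\<^sub>R x \<in> L" "\<exists>k::int. f (real_of_int a *\<^sub>R x) = real m * real_of_int k"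
        using f(1) by (auto simp: L zmod.span_scale linear_scale intro!: exI[of _ "a * k"])
    qed
    moreover have "e i \<in> ?K" if "i < n" for i
      using that eL[OF that] f j
      by (auto simp: congruence_sublattice_def e_def linear_diff linear_scale intro!: exI[of _ 0])
    moreover have "real m *\<^sub>R B ! j \<in> ?K"
      using zmod.span_scale[of "B ! j" "set B" "int m"] BL[OF j(1)] f j
      by (auto simp: congruence_sublattice_def linear_scale L intro!: exI[of _ 1])
    ultimately show "int_span C \<subseteq> ?K"
      unfolding int_span_eq_zmod_span by (intro zmod.span_minimal) (auto simp: C_def set_xs)
    show "?K \<subseteq> int_span C"
    proof
      fix x assume "x \<in> ?K"
      then obtain k :: int where "x \<in> L" and k: "f x = real m * real_of_int k"
        by (auto simp: congruence_sublattice_def)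
      with decompose obtain c :: "nat \<Rightarrow> int" where
        "x = (\<Sum>i\<in>set xs. real_of_int (c i) *\<^sub>R e i) + f x *\<^sub>R B ! j"
        by blast
      then have "x = (\<Sum>i\<in>set xs. real_of_int (c i) *\<^sub>R e i) + real_of_int k *\<^sub>R (real m *\<^sub>R B ! j)"
        by (simp add: k mult.commute)
      then show "x \<in> int_span C"
        unfolding int_span_eq_zmod_span
        by (elim ssubst, intro zmod.span_add zmod.span_sum zmod.span_scale zmod.span_base)
          (simp_all add: C_def)
    qed
  qed
  have "set B \<subseteq> L" by (simp add: L zmod.span_superset)
  then have basis_b: "lattice_basis b L"
    using lattice_basis_of_span[OF B(1), of b] int_span_subset_span[of b] lenb B(2) b by auto
  show inv: "has_invariant_factors ?K L (replicate (n - 1) 1 @ [m])"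
    unfolding has_invariant_factors_iff_adapted_basis ds_def[symmetric] lends
  proof (intro conjI exI[of _ b])
    show "\<forall>d\<in>set ds. 0 < d" using m by (auto simp: ds_def)
    show "\<forall>i. Suc i < n \<longrightarrow> ds ! i dvd ds ! Suc i" by (auto simp: ds_def nth_append)
    show "?K = int_span (map (\<lambda>i. real (ds ! i) *\<^sub>R b ! i) [0..<n])" using C C_eq by simp
  qed (use lenb basis_b in auto)
  then obtain C' A B' where C': "lattice_basis C' ?K" "expresses A C' B'" "smith_diagonal A ds"
    unfolding has_invariant_factors_def ds_def by blast
  then have "length C' = n" using lends by (auto simp: expresses_def smith_diagonal_def)
  with C' show "is_sublattice n ?K L"
    unfolding is_sublattice_def is_lattice_def congruence_sublattice_def by blast
qed

section \<open>Normal forms of linear forms modulo a prime power\<close>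

text \<open>Representatives of the vectors that are nonzero mod \<open>p\<close>, up to scaling by units mod \<open>p ^ r\<close>:
  the position \<open>j\<close> is that of the last entry prime to \<open>p\<close>.\<close>

definition normalized_vectors :: "nat \<Rightarrow> nat \<Rightarrow> nat \<Rightarrow> nat \<Rightarrow> (nat \<Rightarrow> int) set" where
  "normalized_vectors p r n j = PiE {..<n} (\<lambda>i.
     if i < j then {0..<int p ^ r} else if i = j then {1} else {x \<in> {0..<int p ^ r}. int p dvd x})"

lemma card_multiples_below_power:
  fixes p r :: nat
  assumes "p > 0" "r \<ge> 1"
  shows "card {x \<in> {0..<int p ^ r}. int p dvd x} = p ^ (r - 1)"
proof -
  have "{x \<in> {0..<int p ^ r}. int p dvd x} = (*) (int p) ` {0..<int p ^ (r - 1)}"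
  proof -
    have pr: "int p ^ r = int p * int p ^ (r - 1)" using assms(2) by (cases r) auto
    show ?thesis unfolding pr using assms(1)
      by (auto simp: zero_le_mult_iff elim!: dvdE)
  qed
  moreover have "inj_on ((*) (int p)) {0..<int p ^ (r - 1)}"
    using assms(1) by (intro inj_onI) auto
  ultimately show ?thesis by (simp add: card_image flip: of_nat_power)
qed

lemma normalized_vectors_entry:
  assumes "w \<in> normalized_vectors p r n j" "i < n"
  shows "w i \<in> (if i < j then {0..<int p ^ r} else if i = j then {1}
    else {x \<in> {0..<int p ^ r}. int p dvd x})"
  using PiE_mem[OF assms(1)[unfolded normalized_vectors_def], of i] assms(2) by simp

lemma normalized_vectors_pivot:
  assumes "w \<in> normalized_vectors p r n j" "j < n"
  shows "w j = 1"
  using normalized_vectors_entry[OF assms] by simp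

lemma card_normalized_vectors:
  assumes "p > 0" "r \<ge> 1" "j < n"
  shows "card (normalized_vectors p r n j) = p ^ ((n - 1) * (r - 1)) * p ^ j"
proof -
  define g where "g i = (if i < j then p ^ r else if i = j then 1 else p ^ (r - 1))" for i
  have "card (normalized_vectors p r n j) = (\<Prod>i<n. g i)"
    unfolding normalized_vectors_def g_def
    using assms card_multiples_below_power[of p r]
    by (subst card_PiE) (auto intro!: prod.cong simp flip: of_nat_power)
  also have "{..<n} = {..<j} \<union> {j} \<union> {j<..<n}" using assms(3) by auto
  also have "(\<Prod>i\<in>{..<j} \<union> {j} \<union> {j<..<n}. g i) = (\<Prod>i<j. g i) * (\<Prod>i\<in>{j<..<n}. g i)"
    by (subst prod.union_disjoint, simp, simp, force)+ (simp add: g_def)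
  also have "(\<Prod>i<j. g i) = p ^ (r * j)" by (simp add: g_def power_mult)
  also have "(\<Prod>i\<in>{j<..<n}. g i) = p ^ ((r - 1) * (n - 1 - j))"
    by (simp add: g_def power_mult)
  also have "p ^ (r * j) * p ^ ((r - 1) * (n - 1 - j)) = p ^ ((n - 1) * (r - 1)) * p ^ j"
  proof -
    obtain s where s: "r = Suc s" using assms(2) by (cases r) auto
    obtain t where t: "n - 1 = j + t" using assms(3) by (metis less_iff_Suc_add diff_Suc_1)
    show ?thesis unfolding power_add[symmetric] s t by (simp add: algebra_simps)
  qed
  finally show ?thesis .
qed

lemma finite_normalized_vectors: "finite (normalized_vectors p r n j)"
  unfolding normalized_vectors_def
  by (intro finite_PiE) (auto intro: finite_subset[of _ "{0..<int p ^ r}"])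

lemma congruence_sublattice_iff_dvd:
  assumes "x \<in> L" "f x = real_of_int a"
  shows "x \<in> congruence_sublattice L f m \<longleftrightarrow> int m dvd a"
  using assms unfolding congruence_sublattice_def dvd_def
  by simp (metis of_int_eq_iff of_int_mult of_int_of_nat_eq)

text \<open>The values on \<open>B\<close> matter only modulo \<open>m\<close> and up to a common unit factor \<open>u\<close>. This allows
  a form to be replaced by its normal form.\<close>

lemma congruence_sublattice_cong_mod:
  fixes v w :: "nat \<Rightarrow> int" and f g :: "'a::euclidean_space \<Rightarrow> real"
  assumes B: "lattice_basis B L"
    and f: "linear f" "\<And>i. i < length B \<Longrightarrow> f (B ! i) = v i"
    and g: "linear g" "\<And>i. i < length B \<Longrightarrow> g (B ! i) = w i"
    and "coprime u (int m)" "\<And>i. i < length B \<Longrightarrow> [w i = u * v i] (mod int m)"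
  shows "congruence_sublattice L g m = congruence_sublattice L f m"
proof -
  have "x \<in> congruence_sublattice L g m \<longleftrightarrow> x \<in> congruence_sublattice L f m" if x: "x \<in> L" for x
  proof -
    obtain c :: "nat \<Rightarrow> int" where c: "x = (\<Sum>i<length B. real_of_int (c i) *\<^sub>R B ! i)"
      using B x unfolding lattice_basis_def int_span_def by auto
    have fx: "f x = real_of_int (\<Sum>i<length B. c i * v i)"
      unfolding c using f by (auto simp: linear_sum linear_scale intro!: sum.cong)
    have gx: "g x = real_of_int (\<Sum>i<length B. c i * w i)"
      unfolding c using g by (auto simp: linear_sum linear_scale intro!: sum.cong)
    have "[(\<Sum>i<length B. c i * w i) = (\<Sum>i<length B. c i * (u * v i))] (mod int m)"
      using assms(7) by (intro cong_sum cong_mult cong_refl) auto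
    then have "int m dvd (\<Sum>i<length B. c i * w i) \<longleftrightarrow> int m dvd u * (\<Sum>i<length B. c i * v i)"
      by (auto dest: cong_dvd_iff simp: sum_distrib_left mult.left_commute)
    also have "\<dots> \<longleftrightarrow> int m dvd (\<Sum>i<length B. c i * v i)"
      using assms(6) by (simp add: coprime_commute coprime_dvd_mult_right_iff)
    finally show ?thesis
      using congruence_sublattice_iff_dvd[of x L f _ m, OF x fx]
        congruence_sublattice_iff_dvd[of x L g _ m, OF x gx] by simp
  qed
  then show ?thesis by (auto simp: congruence_sublattice_def)
qed

text \<open>The scaling factor is an inverse mod \<open>p ^ r\<close> of the last entry prime to \<open>p\<close>.\<close>

lemma exists_normalized_vector:
  fixes v :: "nat \<Rightarrow> int"
  assumes "prime p" "r \<ge> 1" "i < n" "\<not> int p dvd v i"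
  obtains j w u where "j < n" "w \<in> normalized_vectors p r n j" "coprime u (int (p ^ r))"
    "\<And>i. i < n \<Longrightarrow> [w i = u * v i] (mod int (p ^ r))"
proof -
  have p: "p > 1" using assms(1) by (rule prime_gt_1_nat)
  have m: "int (p ^ r) > 1" using one_less_power[of "int p" r] p assms(2) by simp
  define j where "j = Max {i. i < n \<and> \<not> int p dvd v i}"
  have "j \<in> {i. i < n \<and> \<not> int p dvd v i}"
    unfolding j_def using assms(3,4) by (intro Max_in) auto
  then have j: "j < n" "\<not> int p dvd v j" by auto
  have after: "int p dvd v i" if "j < i" "i < n" for i
    using that Max_ge[of "{i. i < n \<and> \<not> int p dvd v i}" i] unfolding j_def by fastforce
  have "coprime (v j) (int (p ^ r))"
    using j(2) assms(1) prime_imp_coprime[of "int p" "v j"] by (simp add: coprime_commute)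
  then obtain u where u: "[v j * u = 1] (mod int (p ^ r))" using cong_solve_coprime_int by blast
  then have copu: "coprime u (int (p ^ r))"
    by (metis coprime_iff_invertible_int mult.commute)
  define w where "w = (\<lambda>i\<in>{..<n}. (u * v i) mod int (p ^ r))"
  have "w \<in> normalized_vectors p r n j"
    unfolding normalized_vectors_def
  proof (rule PiE_I)
    fix i assume i: "i \<in> {..<n}"
    have "w i \<in> {0..<int p ^ r}" using i p by (simp add: w_def)
    moreover have "w j = 1" using j(1) u m by (simp add: w_def cong_def mult.commute)
    moreover have "int p dvd w i" if "j < i"
      using after[OF that] i assms(2) by (simp add: w_def dvd_mod_iff dvd_mod)
    ultimately show "w i \<in> (if i < j then {0..<int p ^ r} else if i = j then {1}
        else {x \<in> {0..<int p ^ r}. int p dvd x})" by auto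
  qed (simp add: w_def)
  moreover have "[w i = u * v i] (mod int (p ^ r))" if "i < n" for i
    using that by (simp add: w_def cong_def)
  ultimately show thesis using that j(1) copu by blast
qed

text \<open>The vectors \<open>B ! i - w i *\<^sub>R B ! j\<close> lie in the kernel of \<open>f\<close>, hence in the common sublattice;
  applying \<open>g\<close> to them gives \<open>v i \<equiv> w i * v j (mod p ^ r)\<close> for all \<open>i\<close>. If \<open>j < k\<close>, this reads
  \<open>1 \<equiv> w k * v j\<close> at \<open>i = k\<close>, which is absurd as \<open>p\<close> divides \<open>w k\<close>. So \<open>j = k\<close>, hence \<open>v j = 1\<close>,
  and \<open>v\<close> and \<open>w\<close> agree as reduced residues. The hypothesis \<open>j \<le> k\<close> only selects one of two
  symmetric cases.\<close>

lemma normalized_vector_determined: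
  fixes v w :: "nat \<Rightarrow> int" and f g :: "'a::euclidean_space \<Rightarrow> real"
  assumes "prime p" "r \<ge> 1" and B: "lattice_basis B L" "length B = n"
    and j: "j < n" "w \<in> normalized_vectors p r n j"
    and k: "k < n" "v \<in> normalized_vectors p r n k"
    and f: "linear f" "\<And>i. i < n \<Longrightarrow> f (B ! i) = w i"
    and g: "linear g" "\<And>i. i < n \<Longrightarrow> g (B ! i) = v i"
    and eq: "congruence_sublattice L f (p ^ r) = congruence_sublattice L g (p ^ r)"
    and le: "j \<le> k"
  shows "j = k \<and> w = v"
proof -
  let ?m = "int (p ^ r)"
  have wj: "w j = 1" "v k = 1"
    using normalized_vectors_pivot[OF j(2,1)] normalized_vectors_pivot[OF k(2,1)] by simp_all
  have L: "L = zmod.span (set B)" using B(1) by (simp add: lattice_basis_def int_span_eq_zmod_span)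
  have BL: "B ! i \<in> L" if "i < n" for i
    using that B(2) unfolding L by (auto intro: zmod.span_base)
  have vw: "?m dvd v i - w i * v j" if i: "i < n" for i
  proof -
    let ?x = "B ! i - real_of_int (w i) *\<^sub>R B ! j"
    have x: "?x \<in> L" using BL[OF i] BL[OF j(1)] unfolding L
      by (intro zmod.span_diff zmod.span_scale) auto
    have "f ?x = real_of_int 0" using f i j(1) wj by (simp add: linear_diff linear_scale)
    then have "?x \<in> congruence_sublattice L g (p ^ r)"
      unfolding eq[symmetric] using congruence_sublattice_iff_dvd[OF x] by fastforce
    moreover have "g ?x = real_of_int (v i - w i * v j)"
      using g i j(1) by (simp add: linear_diff linear_scale)
    ultimately show ?thesis using congruence_sublattice_iff_dvd[OF x] by blast
  qed
  have p_dvd: "int p dvd ?m" using assms(2) by simp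
  have jk: "j = k"
  proof (rule ccontr)
    assume "j \<noteq> k"
    then have "int p dvd w k"
      using normalized_vectors_entry[OF j(2) k(1)] le by simp
    moreover have "int p dvd 1 - w k * v j"
      using vw[OF k(1)] p_dvd wj(2) by (metis dvd_trans)
    ultimately have "int p dvd (1 - w k * v j) + w k * v j"
      by (intro dvd_add dvd_mult2)
    then have "int p dvd 1" by simp
    then show False using prime_gt_1_nat[OF assms(1)] by simp
  qed
  have "w i = v i" for i
  proof (cases "i < n")
    case True
    have "v i mod ?m = w i mod ?m"
      unfolding mod_eq_dvd_iff using vw[OF True] wj(2) jk by simp
    moreover have "w i \<in> {0..<?m} \<and> v i \<in> {0..<?m}" if "i \<noteq> j"
      using normalized_vectors_entry[OF j(2) True] normalized_vectors_entry[OF k(2) True] that jk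
      by (auto split: if_splits)
    ultimately show ?thesis
      using wj jk by (cases "i = j") simp_all
  next
    case False
    then show ?thesis
      using PiE_arb[OF j(2)[unfolded normalized_vectors_def], of i]
        PiE_arb[OF k(2)[unfolded normalized_vectors_def], of i] by simp
  qed
  with jk show ?thesis by auto
qed

section \<open>The number of co-cyclic sublattices\<close>

lemma num_cocyclic_sublattices_prime_power:
  fixes L :: "'a::euclidean_space set" and n p r :: nat
  assumes "prime p" "is_lattice n L" "n \<ge> 1" "r \<ge> 1"
  shows "num_sublattices L (replicate (n - 1) 1 @ [p ^ r])
    = p ^ ((n - 1) * (r - 1)) * (\<Sum>j<n. p ^ j)"
proof -
  let ?ds = "replicate (n - 1) 1 @ [p ^ r]"
  obtain B where B: "length B = n" "lattice_basis B L" using assms(2) by (auto simp: is_lattice_def)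
  have p: "p > 1" using assms(1) by (rule prime_gt_1_nat)
  define F where "F w = (SOME f. linear f \<and> (\<forall>i<n. f (B ! i) = real_of_int (w i)))" for w :: "nat \<Rightarrow> int"
  have F: "linear (F w)" "i < n \<Longrightarrow> F w (B ! i) = real_of_int (w i)" for w i
  proof -
    have "\<exists>f. linear f \<and> (\<forall>i<n. f (B ! i) = real_of_int (w i))"
      using exists_functional[OF B(2), of "\<lambda>i. real_of_int (w i)"] B(1) by simp
    from someI_ex[OF this] show "linear (F w)" "i < n \<Longrightarrow> F w (B ! i) = real_of_int (w i)"
      unfolding F_def by auto
  qed
  define K where "K w = congruence_sublattice L (F w) (p ^ r)" for w
  \<comment> \<open>Pairing each normal form with its position \<open>j\<close> turns the count into a sum over \<open>j\<close>.\<close>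
  define N where "N = Sigma {..<n} (normalized_vectors p r n)"
  let ?S = "{L'. is_sublattice (length ?ds) L' L \<and> has_invariant_factors L' L ?ds}"
  have len: "length ?ds = n" using assms(3) by simp
  have S_eq: "?S = (K \<circ> snd) ` N"
  proof (intro equalityI subsetI)
    fix L' assume "L' \<in> ?S"
    then obtain f where f: "linear f" "\<And>x. x \<in> L \<Longrightarrow> f x \<in> \<int>" "\<exists>x\<in>L. f x = 1"
      and L': "L' = congruence_sublattice L f (p ^ r)"
      using cocyclic_imp_congruence_sublattice[OF _ assms(3)] by blast
    define v where "v i = \<lfloor>f (B ! i)\<rfloor>" for i
    have v: "f (B ! i) = real_of_int (v i)" if "i < n" for i
    proof -
      have "B ! i \<in> L" using that B
        by (auto simp: lattice_basis_def int_span_eq_zmod_span intro: zmod.span_base)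
      then show ?thesis using f(2) by (auto simp: v_def elim: Ints_cases)
    qed
    obtain x where x: "x \<in> L" "f x = 1" using f(3) by blast
    then obtain c :: "nat \<Rightarrow> int" where c: "x = (\<Sum>i<n. real_of_int (c i) *\<^sub>R B ! i)"
      using B unfolding lattice_basis_def int_span_def by auto
    have "real_of_int (\<Sum>i<n. c i * v i) = 1"
      unfolding x(2)[symmetric] c using f v by (auto simp: linear_sum linear_scale intro!: sum.cong)
    then have "(\<Sum>i<n. c i * v i) = 1" by linarith
    moreover have "int p dvd (\<Sum>i<n. c i * v i)" if "\<forall>i<n. int p dvd v i"
      using that by (intro dvd_sum) auto
    ultimately obtain i where i: "i < n" "\<not> int p dvd v i" using p by auto
    obtain j w u where w: "j < n" "w \<in> normalized_vectors p r n j" "coprime u (int (p ^ r))"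
      "\<And>i. i < n \<Longrightarrow> [w i = u * v i] (mod int (p ^ r))"
      using exists_normalized_vector[of p r i n v, OF assms(1,4) i] by metis
    have "K w = L'"
      unfolding K_def L' using f v F w B
      by (intro congruence_sublattice_cong_mod[OF B(2), of f v "F w" w u]) auto
    moreover have "(j, w) \<in> N" using w by (simp add: N_def)
    ultimately show "L' \<in> (K \<circ> snd) ` N" by force
  next
    fix L' assume "L' \<in> (K \<circ> snd) ` N"
    then obtain j w where w: "j < n" "w \<in> normalized_vectors p r n j" and L': "L' = K w"
      by (auto simp: N_def)
    have "w j = 1" by (rule normalized_vectors_pivot[OF w(2,1)])
    with w(1) show "L' \<in> ?S"
      unfolding L' K_def mem_Collect_eq len
      using normalized_congruence_sublattice_cocyclic[OF B(2,1), of j w "F w" "p ^ r"] F p by auto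
  qed
  have inj: "inj_on (K \<circ> snd) N"
  proof (rule inj_onI)
    fix a b assume ab: "a \<in> N" "b \<in> N" "(K \<circ> snd) a = (K \<circ> snd) b"
    obtain j w k v where a: "a = (j, w)" "b = (k, v)" by (metis surj_pair)
    have jw: "j < n" "w \<in> normalized_vectors p r n j" and kv: "k < n" "v \<in> normalized_vectors p r n k"
      using ab(1,2) by (auto simp: a N_def)
    have eq: "congruence_sublattice L (F w) (p ^ r) = congruence_sublattice L (F v) (p ^ r)"
      using ab(3) by (simp add: a K_def)
    show "a = b"
    proof (cases "j \<le> k")
      case True
      then show ?thesis
        using normalized_vector_determined[OF assms(1,4) B(2,1) jw kv F(1) F(2) F(1) F(2) eq] a by simp
    next
      case False
      then show ?thesis
        using normalized_vector_determined[OF assms(1,4) B(2,1) kv jw F(1) F(2) F(1) F(2) eq[symmetric]] a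
        by simp
    qed
  qed
  have "card ?S = card N" unfolding S_eq by (rule card_image[OF inj])
  also have "card N = (\<Sum>j<n. card (normalized_vectors p r n j))"
    unfolding N_def by (simp add: card_SigmaI finite_normalized_vectors)
  also have "\<dots> = (\<Sum>j<n. p ^ ((n - 1) * (r - 1)) * p ^ j)"
    using p assms(4) by (intro sum.cong) (auto simp: card_normalized_vectors)
  finally show ?thesis by (simp add: num_sublattices_def sum_distrib_left)
qed

lemma num_cocyclic_sublattices_index_one:
  fixes L :: "'a::euclidean_space set"
  assumes "is_lattice n L" "n \<ge> 1"
  shows "num_sublattices L (replicate (n - 1) 1 @ [1]) = 1"
proof -
  let ?ds = "replicate (n - 1) 1 @ [1::nat]"
  obtain B where B: "length B = n" "lattice_basis B L" using assms(1) by (auto simp: is_lattice_def)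
  have ds: "?ds = replicate n 1"
    using assms(2) by (metis Suc_diff_1 Suc_le_eq One_nat_def replicate_append_same replicate_Suc)
  have "int_span (map (\<lambda>i. real (replicate n 1 ! i) *\<^sub>R b ! i) [0..<n]) = int_span b"
    if "length b = n" for b :: "'a list"
    using that by (intro arg_cong[of _ _ int_span]) (auto simp: list_eq_iff_nth_eq)
  then have "has_invariant_factors L' L ?ds \<longleftrightarrow> L' = L" for L'
    unfolding ds has_invariant_factors_iff_adapted_basis using B
    by (auto simp: lattice_basis_def)
  then have "{L'. is_sublattice (length ?ds) L' L \<and> has_invariant_factors L' L ?ds} = {L}"
    using assms by (auto simp: is_sublattice_def)
  then show ?thesis by (simp add: num_sublattices_def)
qed

theorem theorem5p2:
  fixes L :: "'a::euclidean_space set" and n p r :: nat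
  assumes "n \<ge> 1" and "prime p" and "is_lattice n L"
  shows "real (num_sublattices L (replicate (n - 1) 1 @ [p ^ r])) =
    (if r = 0 then 1
     else real p ^ ((n - 1) * (r - 1)) * ((real p ^ n - 1) / (real p - 1)))"
proof (cases "r = 0")
  case True
  then show ?thesis using num_cocyclic_sublattices_index_one[OF assms(3,1)] by simp
next
  case False
  have "real p \<noteq> 1" using prime_gt_1_nat[OF assms(2)] by simp
  then have "(\<Sum>j<n. real p ^ j) = (real p ^ n - 1) / (real p - 1)"
    by (rule geometric_sum)
  then show ?thesis
    using num_cocyclic_sublattices_prime_power[OF assms(2,3,1), of r] False by simp
qed

end
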